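(* Let $p$ and $n$ be positive integers. The set of $p$-Fibonacci words of length $n$ is in bijection with the set of binary words of length $n-1$ (over $\{0,1\}$) that do not contain $p$ consecutive occurrences of the symbol $1$.
   Context: A $p$-Fibonacci word of length $n\ge 1$ is a word $u=u_1u_2\cdots u_n$ over $\{1,\dots,p\}$ with $u_1=p$ and, for $1\le i\le n-1$: if $u_i=1$ then $u_{i+1}=p$; if $2\le u_i\le p$ then $u_{i+1}\in\{u_i-1,\,p\}$. *)

theory Defs
  imports "HOL-Library.Sublist"
begin

(* Words are lists; the letter u_i of the usual 1-based notation is u ! (i - 1). *)

definition fibonacci_words :: "nat \<Rightarrow> nat \<Rightarrow> nat list set" where
  "fibonacci_words p n =
     {u. length u = n \<and> n \<ge> 1 \<and> set u \<subseteq> {1..p} \<and> u ! 0 = p \<and>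
         (\<forall>i < n - 1.
            (u ! i = 1 \<longrightarrow> u ! Suc i = p) \<and>
            (2 \<le> u ! i \<and> u ! i \<le> p \<longrightarrow> u ! Suc i \<in> {u ! i - 1, p}))}"

definition binary_words_avoiding_ones :: "nat \<Rightarrow> nat \<Rightarrow> nat list set" where
  "binary_words_avoiding_ones p m =
     {w. length w = m \<and> set w \<subseteq> {0, 1} \<and> \<not> sublist (replicate p 1) w}"

end

theory Submission
  imports Defs
begin

text \<open>
  A word is encoded by recording, for every letter after the first, whether it is a reset
  to \<open>p\<close> (symbol 0) or a decrement (symbol 1).  A letter \<open>a\<close> is preceded by exactly \<open>p - a\<close>
  decrements since the last reset, and a further decrement is possible iff \<open>a \<ge> 2\<close>; so
  the admissible codes are those in which no \<open>p\<close> decrements occur in a row.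
\<close>

fun fibonacci_tail :: "nat \<Rightarrow> nat \<Rightarrow> nat list \<Rightarrow> bool" where
  "fibonacci_tail p a [] \<longleftrightarrow> True"
| "fibonacci_tail p a (c # v) \<longleftrightarrow> (c = p \<or> 2 \<le> a \<and> c = a - 1) \<and> fibonacci_tail p c v"

text \<open>In state \<open>a\<close> at most \<open>a - 1\<close> further ones may follow before the next zero.\<close>

fun binary_tail :: "nat \<Rightarrow> nat \<Rightarrow> nat list \<Rightarrow> bool" where
  "binary_tail p a [] \<longleftrightarrow> True"
| "binary_tail p a (b # w) \<longleftrightarrow>
     b = 0 \<and> binary_tail p p w \<or> b = 1 \<and> 2 \<le> a \<and> binary_tail p (a - 1) w"

text \<open>A decrement always lands below \<open>p\<close>, so a letter reveals the kind of its
  step without its predecessor; a letterwise \<open>map\<close> therefore suffices as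
  encoding.\<close>

definition step_code :: "nat \<Rightarrow> nat \<Rightarrow> nat" where
  "step_code p c = (if c = p then 0 else 1)"

text \<open>Bridges the indexed condition and recursion on the preceding letter. Letters stay in
  range by themselves: a reset gives \<open>p\<close>, and only letters at least 2 are
  decremented.\<close>

lemma fibonacci_tail_iff_nth:
  assumes "1 \<le> a" "a \<le> p"
  shows "fibonacci_tail p a v \<longleftrightarrow>
    set v \<subseteq> {1..p} \<and>
    (\<forall>i < length v.
       ((a # v) ! i = 1 \<longrightarrow> (a # v) ! Suc i = p) \<and>
       (2 \<le> (a # v) ! i \<and> (a # v) ! i \<le> p \<longrightarrow> (a # v) ! Suc i \<in> {(a # v) ! i - 1, p}))"
  using assms
proof (induction v arbitrary: a)
  case (Cons c v)
  have step: "(c = p \<or> 2 \<le> a \<and> c = a - 1) \<longleftrightarrow>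
      1 \<le> c \<and> c \<le> p \<and> (a = 1 \<longrightarrow> c = p) \<and> (2 \<le> a \<and> a \<le> p \<longrightarrow> c \<in> {a - 1, p})"
    using Cons.prems by auto
  \<comment> \<open>The induction hypothesis needs the new state \<open>c\<close> in range; if it is
    not, both sides fail at \<open>c\<close>.\<close>
  show ?case
  proof (cases "1 \<le> c \<and> c \<le> p")
    case True
    show ?thesis
      unfolding fibonacci_tail.simps step Cons.IH[OF conjunct1[OF True] conjunct2[OF True]]
        length_Cons All_less_Suc2
      using True by auto
  next
    case False
    then show ?thesis using step by auto
  qed
qed simp

text \<open>A block of \<open>p\<close> copies of \<open>x\<close> neither fits into the initial
  run, which is too short, nor crosses \<open>y\<close>. This is how a reset erases the memory of
  earlier ones.\<close>

lemma sublist_replicate_append_Cons: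
  assumes "k < p" "y \<noteq> x"
  shows "sublist (replicate p x) (replicate k x @ y # w) \<longleftrightarrow> sublist (replicate p x) w"
  using assms(1)
proof (induction k)
  case 0
  then show ?case using assms(2) by (cases p) (auto simp: sublist_Cons_right)
next
  case (Suc k)
  have "\<not> prefix (replicate p x) (replicate (Suc k) x @ y # w)"
  proof
    assume "prefix (replicate p x) (replicate (Suc k) x @ y # w)"
    then obtain z where "replicate (Suc k) x @ y # w = replicate p x @ z"
      by (auto simp: prefix_def)
    \<comment> \<open>Position \<open>Suc k\<close> carries \<open>y\<close> on the left, but on the
      right it still lies inside the block of \<open>x\<close>.\<close>
    then have "(replicate (Suc k) x @ y # w) ! Suc k = (replicate p x @ z) ! Suc k"
      by simp
    then show False using Suc.prems assms(2) by (simp add: nth_append del: replicate_Suc)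
  qed
  then show ?case using Suc by (simp add: sublist_Cons_right)
qed

text \<open>The padding by \<open>p - a\<close> ones replays the decrements since the last reset, so
  that the claim can be carried through the induction. In state \<open>p\<close> it vanishes,
  leaving plain avoidance.\<close>

lemma binary_tail_iff_avoids:
  assumes "1 \<le> a" "a \<le> p"
  shows "binary_tail p a w \<longleftrightarrow>
    set w \<subseteq> {0, 1} \<and> \<not> sublist (replicate p 1) (replicate (p - a) 1 @ w)"
  using assms
proof (induction w arbitrary: a)
  case Nil
  then show ?case by (auto dest: sublist_length_le)
next
  case (Cons b w)
  consider "b = 0" | "b = 1" "a = 1" | "b = 1" "2 \<le> a" | "b \<notin> {0, 1}"
    using Cons.prems by fastforce
  then show ?case
  proof cases
    case 1
    then show ?thesis
      using Cons.prems Cons.IH[of p] by (simp add: sublist_replicate_append_Cons)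
  next
    case 2
    \<comment> \<open>In state 1 the padding has \<open>p - 1\<close> ones, so this symbol completes
      a forbidden block.\<close>
    then have "replicate (p - a) 1 @ b # w = replicate p 1 @ w"
      using Cons.prems by (cases p) (simp_all add: replicate_app_Cons_same)
    then have "sublist (replicate p 1) (replicate (p - a) 1 @ b # w)"
      by (metis append_Nil sublist_appendI)
    then show ?thesis using 2 by simp
  next
    case 3
    \<comment> \<open>The new one joins the padding, giving exactly the padding of state
      \<open>a - 1\<close>.\<close>
    then have eq: "replicate (p - a) 1 @ b # w = replicate (p - (a - 1)) 1 @ w"
      using Cons.prems Suc_diff_le[of a p] by (simp add: replicate_app_Cons_same)
    have "binary_tail p (a - 1) w \<longleftrightarrow>
        set w \<subseteq> {0, 1} \<and> \<not> sublist (replicate p 1) (replicate (p - (a - 1)) 1 @ w)"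
      using 3 Cons.prems by (intro Cons.IH) simp_all
    then show ?thesis unfolding eq using 3 by simp
  next
    case 4
    then show ?thesis by auto
  qed
qed

lemma binary_tail_step_code:
  assumes "fibonacci_tail p a v" "1 \<le> a" "a \<le> p"
  shows "binary_tail p a (map (step_code p) v)"
  using assms
proof (induction v arbitrary: a)
  case (Cons c v)
  have c: "c = p \<or> 2 \<le> a \<and> c = a - 1" and v: "fibonacci_tail p c v"
    using Cons.prems(1) by simp_all
  have "1 \<le> c" "c \<le> p" using c Cons.prems(2,3) by linarith+
  with v have "binary_tail p c (map (step_code p) v)" by (rule Cons.IH)
  moreover have "c \<noteq> p" if "c = a - 1" "2 \<le> a"
    using that Cons.prems(3) by linarith
  ultimately show ?case using c step_code_def[of p c] by (cases "c = p") auto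
qed simp

text \<open>From a common state each symbol admits one letter only: \<open>p\<close> for 0 and
  \<open>a - 1\<close> for 1. Hence the two words keep passing through equal states.\<close>

lemma step_code_inj:
  assumes "fibonacci_tail p a v" "fibonacci_tail p a v'" "1 \<le> a" "a \<le> p"
    and "map (step_code p) v = map (step_code p) v'"
  shows "v = v'"
  using assms
proof (induction v arbitrary: a v')
  case (Cons c v)
  then obtain c' u where v': "v' = c' # u" by (cases v') auto
  have c: "c = p \<or> 2 \<le> a \<and> c = a - 1" and c': "c' = p \<or> 2 \<le> a \<and> c' = a - 1"
    and v: "fibonacci_tail p c v" and u: "fibonacci_tail p c' u"
    and code: "step_code p c = step_code p c'"
    and eq: "map (step_code p) v = map (step_code p) u"
    using Cons.prems(1,2,5) v' by simp_all
  have "c = p \<longleftrightarrow> c' = p" using code by (simp add: step_code_def split: if_splits)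
  with c c' have "c = c'" by metis
  moreover have "1 \<le> c" "c \<le> p" using c Cons.prems(3,4) by linarith+
  ultimately show ?case using Cons.IH[OF v] u eq v' by blast
qed simp

lemma step_code_surj:
  assumes "binary_tail p a w" "1 \<le> a" "a \<le> p"
  shows "\<exists>v. fibonacci_tail p a v \<and> map (step_code p) v = w"
  using assms
proof (induction w arbitrary: a)
  case (Cons b w)
  \<comment> \<open>The decoded letter. For \<open>b = 1\<close> the premise forces \<open>a\<close>
    to be at least 2, so \<open>a - 1\<close> is positive and differs from \<open>p\<close>.\<close>
  define c where "c = (if b = 0 then p else a - 1)"
  have "binary_tail p c w" "1 \<le> c" "c \<le> p" using Cons.prems by (auto simp: c_def)
  then obtain v where "fibonacci_tail p c v" "map (step_code p) v = w"
    using Cons.IH by blast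
  then have "fibonacci_tail p a (c # v) \<and> map (step_code p) (c # v) = b # w"
    using Cons.prems by (auto simp: c_def step_code_def)
  then show ?case by (rule exI[of _ "c # v"])
qed simp

lemma fibonacci_words_Suc:
  assumes "p \<ge> 1"
  shows "fibonacci_words p (Suc m) = (#) p ` {v. length v = m \<and> fibonacci_tail p p v}"
proof (intro set_eqI iffI)
  fix u assume u: "u \<in> fibonacci_words p (Suc m)"
  then obtain v where "u = p # v"
    by (cases u) (auto simp: fibonacci_words_def)
  with u assms show "u \<in> (#) p ` {v. length v = m \<and> fibonacci_tail p p v}"
    by (auto simp: fibonacci_words_def fibonacci_tail_iff_nth)
next
  fix u assume "u \<in> (#) p ` {v. length v = m \<and> fibonacci_tail p p v}"
  with assms show "u \<in> fibonacci_words p (Suc m)"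
    by (auto simp: fibonacci_words_def fibonacci_tail_iff_nth)
qed

theorem theorem4:
  fixes p n :: nat
  assumes "p \<ge> 1" and "n \<ge> 1"
  shows "\<exists>f. bij_betw f (fibonacci_words p n) (binary_words_avoiding_ones p (n - 1))"
proof -
  obtain m where m: "n = Suc m" using assms(2) by (cases n) auto
  let ?T = "{v. length v = m \<and> fibonacci_tail p p v}"
  have bin: "binary_words_avoiding_ones p m = {w. length w = m \<and> binary_tail p p w}"
    using assms(1) by (auto simp: binary_words_avoiding_ones_def binary_tail_iff_avoids)
  \<comment> \<open>The first letter is always \<open>p\<close>, so deleting it loses no
    information.\<close>
  have "bij_betw tl (fibonacci_words p n) ?T"
    unfolding m fibonacci_words_Suc[OF assms(1)] by (rule bij_betw_byWitness[where f' = "(#) p"]) auto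
  moreover have "bij_betw (map (step_code p)) ?T (binary_words_avoiding_ones p m)"
    unfolding bij_betw_def
  proof
    show "inj_on (map (step_code p)) ?T"
      by (rule inj_onI) (use assms(1) step_code_inj[of p p] in blast)
    show "map (step_code p) ` ?T = binary_words_avoiding_ones p m"
    proof (intro subset_antisym subsetI)
      fix w assume "w \<in> map (step_code p) ` ?T"
      then show "w \<in> binary_words_avoiding_ones p m"
        unfolding bin using assms(1) by (auto simp: binary_tail_step_code)
    next
      fix w assume "w \<in> binary_words_avoiding_ones p m"
      then have w: "length w = m" "binary_tail p p w" unfolding bin by auto
      then obtain v where "fibonacci_tail p p v" "map (step_code p) v = w"
        using step_code_surj assms(1) by blast
      with w(1) show "w \<in> map (step_code p) ` ?T" by auto
    qed
  qed
  ultimately show ?thesis using m by (metis bij_betw_trans diff_Suc_1)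
qed

end
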